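(* Let $n\ge3$ and $r\in\{1,\dots,n-1\}$. For any $k\in\mathbb{Z}$, $$B^{r,1}\cong\overline{\mathcal{M}}\Big(\prod_{i=1}^rX_{i,k}\Big)$$ as $U_q'(\widehat{\mathfrak{sl}}_n)$-crystals, where $X_{i,k}=Y_{i-1,k+1}^{-1}Y_{i,k}$ and $\overline{\mathcal{M}}(m)$ is the closure of the Nakajima monomial $m$ under the modified operators $\overline{e}_i,\overline{f}_i$, $i\in I$.
   Context: Crystals. $I=\mathbb{Z}/n\mathbb{Z}=\{0,1,\dots,n-1\}$ is the index set of $\widehat{\mathfrak{sl}}_n$ (type $A_{n-1}^{(1)}$), with fundamental weights $\Lambda_i$, and simple roots $\alpha_i=2\Lambda_i-\Lambda_{i-1}-\Lambda_{i+1}$ as $U_q'(\widehat{\mathfrak{sl}}_n)$-weights (that is, modulo the null root $\delta$). A $U_q'(\widehat{\mathfrak{sl}}_n)$-crystal is a set $B$ with maps $e_i,f_i:B\to B\sqcup\{0\}$, $\varepsilon_i,\varphi_i:B\to\mathbb{Z}$ and $\mathrm{wt}:B\to\bigoplus_i\mathbb{Z}\Lambda_i$ satisfying the usual crystal axioms. It is regular if $\varepsilon_i(b)=\max\{p\mid e_i^pb\ne0\}$ and $\varphi_i(b)=\max\{p\mid f_i^pb\neq0\}$. An isomorphism of crystals is a bijection that preserves $\mathrm{wt},\varepsilon_i,\varphi_i$ and commutes with all $e_i,f_i$ (with $0\mapsto 0$). Nakajima monomials. $\mathcal{M}$ is the set of Laurent monomials $m=\prod_{i\in I,k\in\mathbb{Z}}Y_{i,k}^{y_{i,k}}$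 (finitely many nonzero exponents) in commuting variables $Y_{i,k}$. Put $\mathrm{wt}(m)=\sum_{i,k}y_{i,k}\Lambda_i$, $\ \varepsilon_i(m)=-\min_{k\in\mathbb{Z}}\sum_{t\ge k}y_{i,t}$, $\ \varphi_i(m)=\max_{k\in\mathbb{Z}}\sum_{t\le k}y_{i,t}$, $\ k_e(m)=\max\{k\mid \varepsilon_i(m)=-\sum_{t\ge k}y_{i,t}\}$ (used when $\varepsilon_i(m)>0$), $\ k_f(m)=\min\{k\mid\varphi_i(m)=\sum_{t\le k}y_{i,t}\}$ (used when $\varphi_i(m)>0$). With $A_{i,k}=Y_{i,k}Y_{i,k+1}Y_{i-1,k+1}^{-1}Y_{i+1,k}^{-1}$, set $e_i(m)=0$ if $\varepsilon_i(m)=0$ and $e_i(m)=m\,A_{i,k_e(m)-1}$ otherwise; $f_i(m)=0$ if $\varphi_i(m)=0$ and $f_i(m)=m\,A_{i,k_f(m)}^{-1}$ otherwise. Modified operators. Put $X_{i,k}=Y_{i-1,k+1}^{-1}Y_{i,k}$ (first indices mod $n$); distinct $X_{i,k}$ are multiplicatively independent, so a monomial in the $X_{i,k}$ has a unique such expression. For a monomial $m$ in the $X_{i,k}$, $\overline{f}_i(m)=f_i(m)$ if $f_i(m)\neq 0$ and $f_i(m)$, written in the variables $X_{j,l}$, does not contain a factor $X_{j,l}^2$ for any $(j,l)\in I\times\mathbb{Z}$; otherwise $\overline{f}_i(m)=0$. $\overline{e}_i$ is defined in the same way from $e_i$. The set $\overline{\mathcal{M}}(m)$ is the closure of $m$ under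 all $\overline{e}_i,\overline{f}_i$ (excluding $0$), with weight function $\mathrm{wt}(m')=\sum_{i\in I,k\in\mathbb{Z}}y_{i,k}\Lambda_i$ for $m'=\prod_{i\in I,k\in\mathbb{Z}}Y_{i,k}^{y_{i,k}}\in\overline{\mathcal{M}}(m)$, operators $\overline e_i,\overline f_i$, and with $\varepsilon_i,\varphi_i$ on $\overline{\mathcal M}(m)$ being the string lengths of $\overline{e}_i,\overline{f}_i$ (so that it is regular). The Kirillov--Reshetikhin crystal $B^{r,1}$ is the regular $U_q'(\widehat{\mathfrak{sl}}_n)$-crystal realized as follows: its elements are the vectors $(x_1,\dots,x_n)\in\{0,1\}^n$ with $\sum_ix_i=r$ (indices mod $n$, $x_0=x_n$); $\mathrm{wt}(x)=\sum_{i\in I}(x_i-x_{i+1})\Lambda_i$; for $i\in I$, $f_i(x)$ is obtained by replacing $(x_i,x_{i+1})=(1,0)$ by $(0,1)$ if $(x_i,x_{i+1})=(1,0)$, and $f_i(x)=0$ otherwise; $e_i(x)$ is obtained by replacing $(x_i,x_{i+1})=(0,1)$ by $(1,0)$ if $(x_i,x_{i+1})=(0,1)$, and $e_i(x)=0$ otherwise; $\varepsilon_i,\varphi_i$ are the string lengths. *)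

theory Defs
  imports "HOL-Library.Poly_Mapping" "HOL-Library.FuncSet"
begin

section \<open>Crystals of type $A_{n-1}^{(1)}$\<close>

text \<open>The index set $\mathbf Z/n\mathbf Z$ is represented by its least non-negative residues;
  index arithmetic is reduced modulo \<open>n\<close> explicitly.\<close>

definition Idx :: "nat \<Rightarrow> int set"
  where "Idx n = {0..<int n}"

text \<open>The weight lattice $\bigoplus_i \mathbf Z\Lambda_i$ (weights modulo the null root) is the free
  abelian group on \<open>Idx n\<close>.\<close>

definition weights :: "nat \<Rightarrow> (int \<Rightarrow>\<^sub>0 int) set"
  where "weights n = {w. Poly_Mapping.keys w \<subseteq> Idx n}"

definition fund_weight :: "nat \<Rightarrow> int \<Rightarrow> (int \<Rightarrow>\<^sub>0 int)"
  where "fund_weight n i = frag_of (i mod int n)"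

definition simple_root :: "nat \<Rightarrow> int \<Rightarrow> (int \<Rightarrow>\<^sub>0 int)"
  where "simple_root n i =
    frag_cmul 2 (fund_weight n i) - fund_weight n (i - 1) - fund_weight n (i + 1)"

text \<open>\<open>None\<close> plays the role of the extra element $0$.\<close>

record 'b crystal =
  elems :: "'b set"
  wt :: "'b \<Rightarrow> (int \<Rightarrow>\<^sub>0 int)"
  eps :: "int \<Rightarrow> 'b \<Rightarrow> int"
  phi :: "int \<Rightarrow> 'b \<Rightarrow> int"
  e_op :: "int \<Rightarrow> 'b \<Rightarrow> 'b option"
  f_op :: "int \<Rightarrow> 'b \<Rightarrow> 'b option"

text \<open>Since the simple coroots are dual to the fundamental weights, the pairing of \<open>w\<close> with the
  \<open>i\<close>-th simple coroot is the coefficient \<open>Poly_Mapping.lookup w i\<close>.\<close>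

definition is_crystal :: "nat \<Rightarrow> 'b crystal \<Rightarrow> bool"
  where "is_crystal n B \<longleftrightarrow>
    (\<forall>b\<in>elems B. wt B b \<in> weights n) \<and>
    (\<forall>i\<in>Idx n. \<forall>b\<in>elems B.
      phi B i b = eps B i b + Poly_Mapping.lookup (wt B b) i \<and>
      (\<forall>b'. e_op B i b = Some b' \<longrightarrow>
        b' \<in> elems B \<and> wt B b' = wt B b + simple_root n i \<and>
        eps B i b' = eps B i b - 1 \<and> phi B i b' = phi B i b + 1) \<and>
      (\<forall>b'. f_op B i b = Some b' \<longrightarrow>
        b' \<in> elems B \<and> wt B b' = wt B b - simple_root n i \<and>
        eps B i b' = eps B i b + 1 \<and> phi B i b' = phi B i b - 1) \<and>
      (\<forall>b'\<in>elems B. f_op B i b = Some b' \<longleftrightarrow> e_op B i b' = Some b))"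

definition crystal_isomorphism :: "nat \<Rightarrow> 'b crystal \<Rightarrow> 'c crystal \<Rightarrow> ('b \<Rightarrow> 'c) \<Rightarrow> bool"
  where "crystal_isomorphism n B C \<psi> \<longleftrightarrow>
    bij_betw \<psi> (elems B) (elems C) \<and>
    (\<forall>b\<in>elems B. wt C (\<psi> b) = wt B b) \<and>
    (\<forall>i\<in>Idx n. \<forall>b\<in>elems B.
      eps C i (\<psi> b) = eps B i b \<and>
      phi C i (\<psi> b) = phi B i b \<and>
      e_op C i (\<psi> b) = map_option \<psi> (e_op B i b) \<and>
      f_op C i (\<psi> b) = map_option \<psi> (f_op B i b))"

definition crystals_isomorphic :: "nat \<Rightarrow> 'b crystal \<Rightarrow> 'c crystal \<Rightarrow> bool"
  where "crystals_isomorphic n B C \<longleftrightarrow>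
    is_crystal n B \<and> is_crystal n C \<and> (\<exists>\<psi>. crystal_isomorphism n B C \<psi>)"

text \<open>The string length $\max\{p \mid g^p b \ne 0\}$ of a partial map \<open>g\<close> at \<open>b\<close>.\<close>

definition string_length :: "('b \<Rightarrow> 'b option) \<Rightarrow> 'b \<Rightarrow> int"
  where "string_length g b =
    int (GREATEST p. ((\<lambda>x. Option.bind x g) ^^ p) (Some b) \<noteq> None)"


section \<open>Nakajima monomials\<close>

text \<open>The multiplicative group of Laurent monomials in the variables $Y_{i,k}$ is written additively,
  as the free abelian group on the pairs \<open>(i, k)\<close>: a monomial is its finitely supported vector of
  exponents, a product of monomials is a sum and an inverse is a negative.\<close>

type_synonym monomial = "(int \<times> int) \<Rightarrow>\<^sub>0 int"

definition Y :: "nat \<Rightarrow> int \<Rightarrow> int \<Rightarrow> monomial"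
  where "Y n i k = frag_of (i mod int n, k)"

definition A :: "nat \<Rightarrow> int \<Rightarrow> int \<Rightarrow> monomial"
  where "A n i k = Y n i k + Y n i (k + 1) - Y n (i - 1) (k + 1) - Y n (i + 1) k"

definition X :: "nat \<Rightarrow> int \<Rightarrow> int \<Rightarrow> monomial"
  where "X n i k = - Y n (i - 1) (k + 1) + Y n i k"

definition mon_wt :: "nat \<Rightarrow> monomial \<Rightarrow> (int \<Rightarrow>\<^sub>0 int)"
  where "mon_wt n m = frag_extend (\<lambda>(i, k). fund_weight n i) m"

text \<open>The tail sum over \<open>t \<ge> k\<close> and the head sum over \<open>t \<le> k\<close> of the exponents $y_{i,t}$, restricted
  to the finitely many nonzero exponents.\<close>

definition tail_sum :: "int \<Rightarrow> monomial \<Rightarrow> int \<Rightarrow> int"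
  where "tail_sum i m k =
    (\<Sum>t | k \<le> t \<and> Poly_Mapping.lookup m (i, t) \<noteq> 0. Poly_Mapping.lookup m (i, t))"

definition head_sum :: "int \<Rightarrow> monomial \<Rightarrow> int \<Rightarrow> int"
  where "head_sum i m k =
    (\<Sum>t | t \<le> k \<and> Poly_Mapping.lookup m (i, t) \<noteq> 0. Poly_Mapping.lookup m (i, t))"

definition mon_eps :: "int \<Rightarrow> monomial \<Rightarrow> int"
  where "mon_eps i m = - Min (range (tail_sum i m))"

definition mon_phi :: "int \<Rightarrow> monomial \<Rightarrow> int"
  where "mon_phi i m = Max (range (head_sum i m))"

definition k_e :: "int \<Rightarrow> monomial \<Rightarrow> int"
  where "k_e i m = (GREATEST k. mon_eps i m = - tail_sum i m k)"

definition k_f :: "int \<Rightarrow> monomial \<Rightarrow> int"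
  where "k_f i m = (LEAST k. mon_phi i m = head_sum i m k)"

definition mon_e :: "nat \<Rightarrow> int \<Rightarrow> monomial \<Rightarrow> monomial option"
  where "mon_e n i m = (if mon_eps i m = 0 then None else Some (m + A n i (k_e i m - 1)))"

definition mon_f :: "nat \<Rightarrow> int \<Rightarrow> monomial \<Rightarrow> monomial option"
  where "mon_f n i m = (if mon_phi i m = 0 then None else Some (m - A n i (k_f i m)))"

text \<open>The sets under \<open>Min\<close> and \<open>Max\<close> are finite.\<close>

lemma finite_support_row: "finite {t. Poly_Mapping.lookup m (i, t) \<noteq> (0::int)}"
proof -
  have "{t. Poly_Mapping.lookup m (i, t) \<noteq> 0} \<subseteq> snd ` Poly_Mapping.keys m"
    by (force simp: in_keys_iff)
  then show ?thesis
    by (rule finite_subset) simp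
qed

lemma finite_range_tail_sum: "finite (range (tail_sum i m))"
proof -
  let ?S = "{t. Poly_Mapping.lookup m (i, t) \<noteq> 0}"
  have "range (tail_sum i m) \<subseteq> (\<lambda>T. \<Sum>t\<in>T. Poly_Mapping.lookup m (i, t)) ` Pow ?S"
    by (auto simp: tail_sum_def)
  then show ?thesis
    by (rule finite_subset) (simp add: finite_support_row)
qed

lemma finite_range_head_sum: "finite (range (head_sum i m))"
proof -
  let ?S = "{t. Poly_Mapping.lookup m (i, t) \<noteq> 0}"
  have "range (head_sum i m) \<subseteq> (\<lambda>T. \<Sum>t\<in>T. Poly_Mapping.lookup m (i, t)) ` Pow ?S"
    by (auto simp: head_sum_def)
  then show ?thesis
    by (rule finite_subset) (simp add: finite_support_row)
qed


section \<open>The modified operators\<close>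

text \<open>\<open>X_expression n m c\<close>: the monomial \<open>m\<close> equals the product of the $X_{j,l}^{c_{j,l}}$.\<close>

definition X_expression :: "nat \<Rightarrow> monomial \<Rightarrow> ((int \<times> int) \<Rightarrow>\<^sub>0 int) \<Rightarrow> bool"
  where "X_expression n m c \<longleftrightarrow>
    Poly_Mapping.keys c \<subseteq> Idx n \<times> UNIV \<and> m = frag_extend (\<lambda>(j, l). X n j l) c"

definition has_X_square :: "nat \<Rightarrow> monomial \<Rightarrow> bool"
  where "has_X_square n m \<longleftrightarrow>
    (\<exists>c. X_expression n m c \<and> (\<exists>j\<in>Idx n. \<exists>l. Poly_Mapping.lookup c (j, l) \<ge> 2))"

definition remove_X_squares :: "nat \<Rightarrow> monomial option \<Rightarrow> monomial option"
  where "remove_X_squares n z =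
    (case z of None \<Rightarrow> None | Some m \<Rightarrow> if has_X_square n m then None else Some m)"

definition e_bar :: "nat \<Rightarrow> int \<Rightarrow> monomial \<Rightarrow> monomial option"
  where "e_bar n i m = remove_X_squares n (mon_e n i m)"

definition f_bar :: "nat \<Rightarrow> int \<Rightarrow> monomial \<Rightarrow> monomial option"
  where "f_bar n i m = remove_X_squares n (mon_f n i m)"

inductive_set M_bar :: "nat \<Rightarrow> monomial \<Rightarrow> monomial set"
  for n :: nat and m\<^sub>0 :: monomial
  where
    base: "m\<^sub>0 \<in> M_bar n m\<^sub>0"
  | e_step: "\<lbrakk>m \<in> M_bar n m\<^sub>0; i \<in> Idx n; e_bar n i m = Some m'\<rbrakk> \<Longrightarrow> m' \<in> M_bar n m\<^sub>0"
  | f_step: "\<lbrakk>m \<in> M_bar n m\<^sub>0; i \<in> Idx n; f_bar n i m = Some m'\<rbrakk> \<Longrightarrow> m' \<in> M_bar n m\<^sub>0"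

definition M_bar_crystal :: "nat \<Rightarrow> monomial \<Rightarrow> monomial crystal"
  where "M_bar_crystal n m\<^sub>0 =
    \<lparr>elems = M_bar n m\<^sub>0,
     wt = mon_wt n,
     eps = (\<lambda>i. string_length (e_bar n i)),
     phi = (\<lambda>i. string_length (f_bar n i)),
     e_op = e_bar n,
     f_op = f_bar n\<rparr>"

text \<open>The $X_{j,l}$ are multiplicatively independent, so the expression quantified over in
  \<open>has_X_square\<close> is unique.\<close>

lemma lookup_X_product:
  assumes n: "n > 0" and c: "Poly_Mapping.keys c \<subseteq> Idx n \<times> UNIV" and j: "j \<in> Idx n"
  shows "Poly_Mapping.lookup (frag_extend (\<lambda>(j, l). X n j l) c) (j, l) =
    Poly_Mapping.lookup c (j, l) - Poly_Mapping.lookup c ((j + 1) mod int n, l - 1)"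
proof -
  have eq: "Poly_Mapping.lookup (X n a b) (j, l) =
      (if (a, b) = (j, l) then 1 else 0) - (if (a, b) = ((j + 1) mod int n, l - 1) then 1 else 0)"
    if "a \<in> Idx n" for a b
  proof -
    have "a mod int n = a" and jm: "j mod int n = j"
      using that j by (auto simp: Idx_def)
    moreover have "(a - 1) mod int n = j \<longleftrightarrow> a = (j + 1) mod int n"
    proof
      assume "(a - 1) mod int n = j"
      then have "(j + 1) mod int n = (a - 1 + 1) mod int n"
        by (metis mod_add_left_eq)
      then show "a = (j + 1) mod int n"
        using \<open>a mod int n = a\<close> by simp
    next
      assume "a = (j + 1) mod int n"
      then have "(a - 1) mod int n = (j + 1 - 1) mod int n"
        by (metis mod_diff_left_eq)
      then show "(a - 1) mod int n = j"
        using jm by simp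
    qed
    ultimately show ?thesis
      by (auto simp: X_def Y_def lookup_add lookup_minus)
  qed
  have "Poly_Mapping.lookup (frag_extend (\<lambda>(j, l). X n j l) c) (j, l) =
      (\<Sum>p\<in>Poly_Mapping.keys c. Poly_Mapping.lookup c p * Poly_Mapping.lookup (X n (fst p) (snd p)) (j, l))"
    by (simp add: frag_extend_def lookup_sum case_prod_beta)
  also have "\<dots> = (\<Sum>p\<in>Poly_Mapping.keys c. (if p = (j, l) then Poly_Mapping.lookup c p else 0) -
      (if p = ((j + 1) mod int n, l - 1) then Poly_Mapping.lookup c p else 0))"
  proof (rule sum.cong)
    fix p assume "p \<in> Poly_Mapping.keys c"
    then have "fst p \<in> Idx n" using c by auto
    then show "Poly_Mapping.lookup c p * Poly_Mapping.lookup (X n (fst p) (snd p)) (j, l) =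
       (if p = (j, l) then Poly_Mapping.lookup c p else 0) -
       (if p = ((j + 1) mod int n, l - 1) then Poly_Mapping.lookup c p else 0)"
      by (simp add: eq right_diff_distrib)
  qed simp
  also have "\<dots> = Poly_Mapping.lookup c (j, l) - Poly_Mapping.lookup c ((j + 1) mod int n, l - 1)"
    by (simp add: sum_subtractf in_keys_iff)
  finally show ?thesis .
qed

lemma X_expression_unique:
  assumes n: "n > 0" and c: "X_expression n m c" and d: "X_expression n m d"
  shows "c = d"
proof -
  define b where "b = c - d"
  have kb: "Poly_Mapping.keys b \<subseteq> Idx n \<times> UNIV"
    using c d keys_diff[of c d] unfolding b_def X_expression_def by blast
  have zero: "frag_extend (\<lambda>(j, l). X n j l) b = 0"
    using c d by (simp add: b_def X_expression_def frag_extend_diff)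
  have step: "Poly_Mapping.lookup b (j, l) = Poly_Mapping.lookup b ((j + 1) mod int n, l - 1)" if "j \<in> Idx n" for j l
    using lookup_X_product[OF n kb that, of l] by (simp add: zero)
  have iter: "Poly_Mapping.lookup b (j, l) = Poly_Mapping.lookup b ((j + int p) mod int n, l - int p)"
    if "j \<in> Idx n" for j l p
  proof (induction p)
    case 0
    then show ?case using that by (simp add: Idx_def)
  next
    case (Suc p)
    have "(j + int p) mod int n \<in> Idx n"
      using n by (simp add: Idx_def)
    note step[OF this, of "l - int p"]
    moreover have "((j + int p) mod int n + 1) mod int n = (j + int (Suc p)) mod int n"
      by (simp add: mod_add_right_eq add_ac)
    moreover have "l - int p - 1 = l - int (Suc p)"
      by simp
    ultimately show ?case
      using Suc by simp
  qed
  have "Poly_Mapping.lookup b (j, l) = 0" for j l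
  proof (rule ccontr)
    assume nz: "Poly_Mapping.lookup b (j, l) \<noteq> 0"
    then have j: "j \<in> Idx n"
      using kb by (auto simp: in_keys_iff subset_iff)
    have "((j + int p) mod int n, l - int p) \<in> Poly_Mapping.keys b" for p
      using iter[OF j, of l p] nz by (simp add: in_keys_iff)
    then have "range (\<lambda>p. ((j + int p) mod int n, l - int p)) \<subseteq> Poly_Mapping.keys b"
      by auto
    then have "finite (range (\<lambda>p. ((j + int p) mod int n, l - int p)))"
      using finite_subset finite_keys by blast
    moreover have "inj (\<lambda>p. ((j + int p) mod int n, l - int p))"
      by (auto simp: inj_on_def)
    ultimately show False
      using finite_imageD infinite_UNIV_nat by blast
  qed
  then have "b = 0"
    by (intro poly_mapping_eqI) auto
  then show ?thesis
    by (simp add: b_def)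
qed


section \<open>The Kirillov--Reshetikhin crystal $B^{r,1}$\<close>

text \<open>Vectors are indexed by \<open>Idx n\<close>, so that the coordinate $x_n = x_0$ is stored at index \<open>0\<close>.\<close>

definition KR_elems :: "nat \<Rightarrow> nat \<Rightarrow> (int \<Rightarrow> int) set"
  where "KR_elems n r = {x \<in> Idx n \<rightarrow>\<^sub>E {0, 1}. (\<Sum>i\<in>Idx n. x i) = int r}"

definition KR_wt :: "nat \<Rightarrow> (int \<Rightarrow> int) \<Rightarrow> (int \<Rightarrow>\<^sub>0 int)"
  where "KR_wt n x = (\<Sum>i\<in>Idx n. frag_cmul (x i - x ((i + 1) mod int n)) (fund_weight n i))"

definition KR_e :: "nat \<Rightarrow> int \<Rightarrow> (int \<Rightarrow> int) \<Rightarrow> (int \<Rightarrow> int) option"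
  where "KR_e n i x =
    (if x i = 0 \<and> x ((i + 1) mod int n) = 1
     then Some (x(i := 1, (i + 1) mod int n := 0)) else None)"

definition KR_f :: "nat \<Rightarrow> int \<Rightarrow> (int \<Rightarrow> int) \<Rightarrow> (int \<Rightarrow> int) option"
  where "KR_f n i x =
    (if x i = 1 \<and> x ((i + 1) mod int n) = 0
     then Some (x(i := 0, (i + 1) mod int n := 1)) else None)"

definition KR_crystal :: "nat \<Rightarrow> nat \<Rightarrow> (int \<Rightarrow> int) crystal"
  where "KR_crystal n r =
    \<lparr>elems = KR_elems n r,
     wt = KR_wt n,
     eps = (\<lambda>i. string_length (KR_e n i)),
     phi = (\<lambda>i. string_length (KR_f n i)),
     e_op = KR_e n,
     f_op = KR_f n\<rparr>"

end

theory Submission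
  imports Defs
begin

text \<open>Since $A_{i,k} = X_{i,k} X_{i+1,k}^{-1}$, the Nakajima operators act on a squarefree product of
  variables $X_{j,k}$ of a single level \<open>k\<close> by exchanging $X_{i,k}$ and $X_{i+1,k}$, and the
  modification discards exactly the results in which the new factor was already present. Hence
  $x \mapsto \prod_j X_{j,k}^{x_j}$ intertwines the operators of $B^{r,1}$ with the modified ones. Its
  image is the whole closure because $B^{r,1}$ is connected: listing the positions as $1,\dots,n$,
  every vector other than $(1^r,0^{n-r})$ has an ascent at some $i \neq 0$, where $e_i$ applies and
  moves a one to the left.\<close>

section \<open>String lengths and transport of crystals\<close>

lemma funpow_bind_None:
  fixes g :: "'b \<Rightarrow> 'b option"
  shows "((\<lambda>x. Option.bind x g) ^^ p) None = None"
  by (induction p) auto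

lemma string_length_None:
  assumes "g b = None"
  shows "string_length g b = 0"
proof -
  have "((\<lambda>x. Option.bind x g) ^^ p) (Some b) \<noteq> None \<longleftrightarrow> p = 0" for p
    using assms by (cases p) (simp_all add: funpow_bind_None del: funpow.simps add: funpow_Suc_right)
  then show ?thesis
    by (simp add: string_length_def Greatest_equality del: not_None_eq)
qed

lemma string_length_Some_None:
  assumes "g b = Some b'" "g b' = None"
  shows "string_length g b = 1"
proof -
  have "((\<lambda>x. Option.bind x g) ^^ p) (Some b) \<noteq> None \<longleftrightarrow> p \<le> 1" for p
  proof (cases p)
    case (Suc q)
    then show ?thesis
      using assms
      by (cases q) (simp_all add: funpow_bind_None del: funpow.simps add: funpow_Suc_right)
  qed simp
  then show ?thesis
    by (simp add: string_length_def Greatest_equality del: not_None_eq)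
qed

text \<open>Induction on the number of steps shows that all iterates correspond and stay in
  \<open>S\<close>. No injectivity of \<psi> is involved, because \<open>map_option\<close> both
  preserves and reflects \<open>None\<close>.\<close>

lemma string_length_map:
  assumes comm: "\<And>b. b \<in> S \<Longrightarrow> h (\<psi> b) = map_option \<psi> (g b)"
    and closed: "\<And>b b'. b \<in> S \<Longrightarrow> g b = Some b' \<Longrightarrow> b' \<in> S"
    and b: "b \<in> S"
  shows "string_length h (\<psi> b) = string_length g b"
proof -
  have "((\<lambda>x. Option.bind x h) ^^ p) (Some (\<psi> b)) =
      map_option \<psi> (((\<lambda>x. Option.bind x g) ^^ p) (Some b)) \<and>
      (\<forall>b'. ((\<lambda>x. Option.bind x g) ^^ p) (Some b) = Some b' \<longrightarrow> b' \<in> S)" for p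
  proof (induction p)
    case (Suc p)
    then show ?case
      using comm closed by (cases "((\<lambda>x. Option.bind x g) ^^ p) (Some b)") auto
  qed (use b in simp)
  then show ?thesis
    by (simp add: string_length_def del: not_None_eq)
qed

text \<open>This spares a direct check of the axioms on monomials: the closure inherits them from
  B^{r,1}. Injectivity of \<psi> enters only in the axiom relating \<open>f_op\<close> to
  \<open>e_op\<close>, where equality of images has to be pulled back.\<close>

lemma is_crystal_transport:
  assumes B: "is_crystal n B" and iso: "crystal_isomorphism n B C \<psi>"
  shows "is_crystal n C"
proof -
  have inj: "inj_on \<psi> (elems B)" and img: "elems C = \<psi> ` elems B"
    using iso by (auto simp: crystal_isomorphism_def bij_betw_def)
  have wt: "wt C (\<psi> b) = wt B b" if "b \<in> elems B" for b
    using iso that by (auto simp: crystal_isomorphism_def)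
  have ops: "eps C i (\<psi> b) = eps B i b" "phi C i (\<psi> b) = phi B i b"
    "e_op C i (\<psi> b) = map_option \<psi> (e_op B i b)" "f_op C i (\<psi> b) = map_option \<psi> (f_op B i b)"
    if "i \<in> Idx n" "b \<in> elems B" for i b
    using iso that by (auto simp: crystal_isomorphism_def)
  have B_phi: "phi B i b = eps B i b + Poly_Mapping.lookup (wt B b) i"
    if "i \<in> Idx n" "b \<in> elems B" for i b
    using B that unfolding is_crystal_def by blast
  have B_e: "b' \<in> elems B" "wt B b' = wt B b + simple_root n i"
    "eps B i b' = eps B i b - 1" "phi B i b' = phi B i b + 1"
    if "i \<in> Idx n" "b \<in> elems B" "e_op B i b = Some b'" for i b b'
    using B that unfolding is_crystal_def by blast+
  have B_f: "b' \<in> elems B" "wt B b' = wt B b - simple_root n i"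
    "eps B i b' = eps B i b + 1" "phi B i b' = phi B i b - 1"
    if "i \<in> Idx n" "b \<in> elems B" "f_op B i b = Some b'" for i b b'
    using B that unfolding is_crystal_def by blast+
  have inverse: "f_op C i (\<psi> b) = Some (\<psi> b') \<longleftrightarrow> e_op C i (\<psi> b') = Some (\<psi> b)"
    if i: "i \<in> Idx n" and b: "b \<in> elems B" and b': "b' \<in> elems B" for i b b'
  proof -
    have "f_op C i (\<psi> b) = Some (\<psi> b') \<longleftrightarrow> f_op B i b = Some b'"
      using B_f(1)[OF i b] b' inj by (auto simp: ops(4)[OF i b] dest: inj_onD)
    also have "\<dots> \<longleftrightarrow> e_op B i b' = Some b"
      using B i b b' unfolding is_crystal_def by blast
    also have "\<dots> \<longleftrightarrow> e_op C i (\<psi> b') = Some (\<psi> b)"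
      using B_e(1)[OF i b'] b inj by (auto simp: ops(3)[OF i b'] dest: inj_onD)
    finally show ?thesis .
  qed
  show ?thesis
    unfolding is_crystal_def img ball_simps
  proof (intro conjI ballI allI impI)
    fix b assume b: "b \<in> elems B"
    then show "wt C (\<psi> b) \<in> weights n"
      using B unfolding is_crystal_def wt[OF b] by blast
  next
    fix i b assume ib: "i \<in> Idx n" "b \<in> elems B"
    show "phi C i (\<psi> b) = eps C i (\<psi> b) + Poly_Mapping.lookup (wt C (\<psi> b)) i"
      by (simp add: wt ops ib B_phi)
    {
      fix c assume "e_op C i (\<psi> b) = Some c"
      then obtain b' where b': "e_op B i b = Some b'" "c = \<psi> b'"
        by (auto simp: ops(3)[OF ib])
      note e = B_e[OF ib b'(1)]
      show "c \<in> \<psi> ` elems B" "wt C c = wt C (\<psi> b) + simple_root n i"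
        "eps C i c = eps C i (\<psi> b) - 1" "phi C i c = phi C i (\<psi> b) + 1"
        by (simp_all add: b'(2) wt ops(1,2) ib e)
    }
    {
      fix c assume "f_op C i (\<psi> b) = Some c"
      then obtain b' where b': "f_op B i b = Some b'" "c = \<psi> b'"
        by (auto simp: ops(4)[OF ib])
      note f = B_f[OF ib b'(1)]
      show "c \<in> \<psi> ` elems B" "wt C c = wt C (\<psi> b) - simple_root n i"
        "eps C i c = eps C i (\<psi> b) + 1" "phi C i c = phi C i (\<psi> b) - 1"
        by (simp_all add: b'(2) wt ops(1,2) ib f)
    }
    fix b' assume "b' \<in> elems B"
    then show "f_op C i (\<psi> b) = Some (\<psi> b') \<longleftrightarrow> e_op C i (\<psi> b') = Some (\<psi> b)"
      using inverse ib by blast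
  qed
qed


section \<open>The crystal $B^{r,1}$\<close>

lemma finite_Idx [simp]: "finite (Idx n)"
  by (simp add: Idx_def)

lemma Idx_mod: "i \<in> Idx n \<Longrightarrow> i mod int n = i"
  by (auto simp: Idx_def)

lemma succ_in_Idx:
  assumes "n \<ge> 3"
  shows "(i + 1) mod int n \<in> Idx n"
  using assms by (simp add: Idx_def)

lemma succ_neq:
  assumes "n \<ge> 3" "i \<in> Idx n"
  shows "(i + 1) mod int n \<noteq> i"
  using assms by (cases "i + 1 = int n") (auto simp: Idx_def)

lemma succ_inj:
  assumes "i \<in> Idx n" "j \<in> Idx n" "(i + 1) mod int n = (j + 1) mod int n"
  shows "i = j"
proof -
  have "(i + 1 - 1) mod int n = (j + 1 - 1) mod int n"
    using assms(3) by (metis mod_diff_left_eq)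
  then show ?thesis
    using assms(1,2) by (simp add: Idx_mod)
qed

lemma bij_betw_succ:
  assumes "n \<ge> 3"
  shows "bij_betw (\<lambda>i. (i + 1) mod int n) (Idx n) (Idx n)"
proof -
  have "inj_on (\<lambda>i. (i + 1) mod int n) (Idx n)"
    by (auto intro: inj_onI succ_inj)
  moreover have "(\<lambda>i. (i + 1) mod int n) ` Idx n \<subseteq> Idx n"
    using succ_in_Idx[OF assms] by auto
  ultimately show ?thesis
    by (simp add: bij_betw_def endo_inj_surj)
qed

lemma sum_fun_upd:
  fixes g :: "'a \<Rightarrow> 'b \<Rightarrow> 'c::ab_group_add"
  assumes "finite S" "a \<in> S"
  shows "(\<Sum>i\<in>S. g i ((x(a := v)) i)) = (\<Sum>i\<in>S. g i (x i)) + (g a v - g a (x a))"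
proof -
  have "(\<Sum>i\<in>S - {a}. g i ((x(a := v)) i)) = (\<Sum>i\<in>S - {a}. g i (x i))"
    by (rule sum.cong) auto
  then show ?thesis
    using assms by (simp add: sum.remove[of S a])
qed

text \<open>An operator touches only the entries at \<open>i\<close> and its successor. With
  \<open>g\<close> depending on index and value, the same formula handles the entry sum, the weight,
  the potential of the connectedness proof, and the monomial.\<close>

lemma sum_swap_upd:
  fixes g :: "int \<Rightarrow> int \<Rightarrow> 'c::ab_group_add"
  assumes "n \<ge> 3" "i \<in> Idx n"
  shows "(\<Sum>j\<in>Idx n. g j ((x(i := u, (i + 1) mod int n := v)) j)) =
    (\<Sum>j\<in>Idx n. g j (x j)) + (g i u - g i (x i)) +
    (g ((i + 1) mod int n) v - g ((i + 1) mod int n) (x ((i + 1) mod int n)))"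
  using assms succ_in_Idx[OF assms(1), of i] succ_neq[OF assms]
  by (simp only: sum_fun_upd finite_Idx fun_upd_other not_False_eq_True)

lemma KR_elems_value: "x \<in> KR_elems n r \<Longrightarrow> i \<in> Idx n \<Longrightarrow> x i = 0 \<or> x i = 1"
  by (auto simp: KR_elems_def dest: PiE_mem)

text \<open>Both operators exchange two adjacent entries, so one closure statement serves
  \<open>KR_e\<close> and \<open>KR_f\<close>.\<close>

lemma KR_elems_swap:
  assumes n: "n \<ge> 3" and i: "i \<in> Idx n" and x: "x \<in> KR_elems n r"
    and u: "u = x ((i + 1) mod int n)" and v: "v = x i"
  shows "x(i := u, (i + 1) mod int n := v) \<in> KR_elems n r"
proof -
  let ?y = "x(i := u, (i + 1) mod int n := v)"
  have "u \<in> {0, 1}" "v \<in> {0, 1}"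
    using KR_elems_value[OF x i] KR_elems_value[OF x succ_in_Idx[OF n]] u v by auto
  then have "?y \<in> Idx n \<rightarrow>\<^sub>E {0, 1}"
    using x i succ_in_Idx[OF n, of i] by (auto simp: KR_elems_def PiE_iff extensional_def)
  moreover have "(\<Sum>j\<in>Idx n. ?y j) = (\<Sum>j\<in>Idx n. x j)"
    using sum_swap_upd[OF n i, of "\<lambda>_ a. a" x u v] u v by simp
  ultimately show ?thesis
    using x by (simp add: KR_elems_def)
qed

lemma KR_e_closed:
  assumes "n \<ge> 3" "i \<in> Idx n" "x \<in> KR_elems n r" "KR_e n i x = Some y"
  shows "y \<in> KR_elems n r"
  using assms KR_elems_swap[OF assms(1-3) refl refl] by (auto simp: KR_e_def split: if_splits)

lemma KR_f_closed:
  assumes "n \<ge> 3" "i \<in> Idx n" "x \<in> KR_elems n r" "KR_f n i x = Some y"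
  shows "y \<in> KR_elems n r"
  using assms KR_elems_swap[OF assms(1-3) refl refl] by (auto simp: KR_f_def split: if_splits)

lemma KR_f_iff_KR_e:
  assumes "n \<ge> 3" "i \<in> Idx n"
  shows "KR_f n i x = Some y \<longleftrightarrow> KR_e n i y = Some x"
  using succ_neq[OF assms] by (auto simp: KR_f_def KR_e_def fun_eq_iff)

text \<open>A move sets entry \<open>i\<close> to 1, which blocks a second move. This relies on
  \<open>i\<close> being different from its cyclic successor.\<close>

lemma string_length_KR_e:
  assumes "n \<ge> 3" "i \<in> Idx n"
  shows "string_length (KR_e n i) x = (if x i = 0 \<and> x ((i + 1) mod int n) = 1 then 1 else 0)"
proof (cases "KR_e n i x")
  case None
  then show ?thesis
    by (auto simp: string_length_None) (auto simp: KR_e_def)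
next
  case (Some y)
  then have "KR_e n i y = None"
    using succ_neq[OF assms] by (auto simp: KR_e_def split: if_splits)
  with Some show ?thesis
    by (auto simp: string_length_Some_None) (auto simp: KR_e_def split: if_splits)
qed

lemma string_length_KR_f:
  assumes "n \<ge> 3" "i \<in> Idx n"
  shows "string_length (KR_f n i) x = (if x i = 1 \<and> x ((i + 1) mod int n) = 0 then 1 else 0)"
proof (cases "KR_f n i x")
  case None
  then show ?thesis
    by (auto simp: string_length_None) (auto simp: KR_f_def)
next
  case (Some y)
  then have "KR_f n i y = None"
    using succ_neq[OF assms] by (auto simp: KR_f_def split: if_splits)
  with Some show ?thesis
    by (auto simp: string_length_Some_None) (auto simp: KR_f_def split: if_splits)
qed

section \<open>Weights and the crystal axioms for B^{r,1}\<close>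

lemma frag_cmul_diff_distrib2: "frag_cmul c (a - b) = frag_cmul c a - frag_cmul c b"
  by (simp add: right_diff_distrib lookup_minus poly_mapping_eqI)

lemma fund_weight_mod [simp]: "fund_weight n (i mod int n) = fund_weight n i"
  by (simp add: fund_weight_def)

lemma fund_weight_succ_diff [simp]: "fund_weight n ((i + 1) mod int n - 1) = fund_weight n i"
  by (simp add: fund_weight_def mod_diff_left_eq)

text \<open>Cyclic summation by parts. The entry at \<open>i\<close> now contributes \<Lambda>_i -
  \<Lambda>_{i-1}, which is the weight of X_{i,k}; this form is linear entry by entry and can be
  compared with monomials.\<close>

lemma KR_wt_eq:
  assumes "n \<ge> 3"
  shows "KR_wt n x = (\<Sum>i\<in>Idx n. frag_cmul (x i) (fund_weight n i - fund_weight n (i - 1)))"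
proof -
  have "(\<Sum>i\<in>Idx n. frag_cmul (x ((i + 1) mod int n)) (fund_weight n i)) =
      (\<Sum>i\<in>Idx n. frag_cmul (x i) (fund_weight n (i - 1)))"
    using sum.reindex_bij_betw[OF bij_betw_succ[OF assms],
        of "\<lambda>i. frag_cmul (x i) (fund_weight n (i - 1))"] by simp
  then show ?thesis
    by (simp add: KR_wt_def frag_cmul_diff_distrib frag_cmul_diff_distrib2 sum_subtractf)
qed

lemma lookup_KR_wt:
  assumes "i \<in> Idx n"
  shows "Poly_Mapping.lookup (KR_wt n x) i = x i - x ((i + 1) mod int n)"
proof -
  have "Poly_Mapping.lookup (KR_wt n x) i =
      (\<Sum>j\<in>Idx n. if j = i then x j - x ((j + 1) mod int n) else 0)"
    unfolding KR_wt_def lookup_sum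
    by (rule sum.cong) (auto simp: fund_weight_def Idx_mod)
  then show ?thesis
    using assms by simp
qed

lemma KR_wt_in_weights: "KR_wt n x \<in> weights n"
proof -
  have "Poly_Mapping.lookup (KR_wt n x) i = 0" if "i \<notin> Idx n" for i
    unfolding KR_wt_def lookup_sum
    by (rule sum.neutral) (use that in \<open>auto simp: fund_weight_def Idx_mod\<close>)
  then show ?thesis
    by (auto simp: weights_def in_keys_iff)
qed

text \<open>The coefficient of \<open>d\<close> is (\<Lambda>_i - \<Lambda>_{i-1}) -
  (\<Lambda>_{i+1} - \<Lambda>_i) = \<alpha>_i.\<close>

lemma KR_wt_swap:
  assumes "n \<ge> 3" "i \<in> Idx n"
  shows "KR_wt n (x(i := x i + d, (i + 1) mod int n := x ((i + 1) mod int n) - d)) =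
    KR_wt n x + frag_cmul d (simple_root n i)"
  unfolding KR_wt_eq[OF assms(1)] fund_weight_mod fund_weight_succ_diff
    sum_swap_upd[OF assms, of "\<lambda>i a. frag_cmul a (fund_weight n i - fund_weight n (i - 1))"]
  by (intro poly_mapping_eqI) (simp add: simple_root_def lookup_add lookup_minus algebra_simps)

lemma is_crystal_KR:
  assumes n: "n \<ge> 3"
  shows "is_crystal n (KR_crystal n r)"
proof -
  have e: "y \<in> KR_elems n r" "KR_wt n y = KR_wt n x + simple_root n i"
    "string_length (KR_e n i) y = string_length (KR_e n i) x - 1"
    "string_length (KR_f n i) y = string_length (KR_f n i) x + 1"
    if i: "i \<in> Idx n" and x: "x \<in> KR_elems n r" and y: "KR_e n i x = Some y" for i x y
  proof -
    show "y \<in> KR_elems n r"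
      using KR_e_closed[OF n i x y] .
    have yy: "x i = 0" "x ((i + 1) mod int n) = 1" "y = x(i := 1, (i + 1) mod int n := 0)"
      using y by (auto simp: KR_e_def split: if_splits)
    then show "KR_wt n y = KR_wt n x + simple_root n i"
      using KR_wt_swap[OF n i, of x 1] by simp
    show "string_length (KR_e n i) y = string_length (KR_e n i) x - 1"
      "string_length (KR_f n i) y = string_length (KR_f n i) x + 1"
      using yy succ_neq[OF n i] by (simp_all add: string_length_KR_e string_length_KR_f n i)
  qed
  have f: "y \<in> KR_elems n r" "KR_wt n y = KR_wt n x - simple_root n i"
    "string_length (KR_e n i) y = string_length (KR_e n i) x + 1"
    "string_length (KR_f n i) y = string_length (KR_f n i) x - 1"
    if i: "i \<in> Idx n" and x: "x \<in> KR_elems n r" and y: "KR_f n i x = Some y" for i x y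
  proof -
    show y_in: "y \<in> KR_elems n r"
      using KR_f_closed[OF n i x y] .
    \<comment> \<open>The claims for \<open>KR_f\<close> are those for \<open>KR_e\<close>, read
      along the inverse arrow from \<open>y\<close> to \<open>x\<close>.\<close>
    have "KR_e n i y = Some x"
      using y KR_f_iff_KR_e[OF n i] by simp
    from e(2-4)[OF i y_in this]
    show "KR_wt n y = KR_wt n x - simple_root n i"
      "string_length (KR_e n i) y = string_length (KR_e n i) x + 1"
      "string_length (KR_f n i) y = string_length (KR_f n i) x - 1"
      by simp_all
  qed
  have balance: "string_length (KR_f n i) x =
      string_length (KR_e n i) x + Poly_Mapping.lookup (KR_wt n x) i"
    if i: "i \<in> Idx n" and x: "x \<in> KR_elems n r" for i x
    using KR_elems_value[OF x i] KR_elems_value[OF x succ_in_Idx[OF n, of i]]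
    by (auto simp: string_length_KR_e string_length_KR_f lookup_KR_wt n i)
  show ?thesis
    unfolding is_crystal_def KR_crystal_def crystal.simps
    by (intro conjI ballI allI impI)
      ((blast intro: e f balance KR_wt_in_weights)+, simp only: KR_f_iff_KR_e[OF n])
qed

section \<open>Connectedness of B^{r,1}\<close>

definition KR_top :: "nat \<Rightarrow> nat \<Rightarrow> int \<Rightarrow> int"
  where "KR_top n r = (\<lambda>i\<in>Idx n. if i \<in> {1..int r} then 1 else 0)"

lemma sum_KR_top:
  assumes "r < n"
  shows "(\<Sum>i\<in>Idx n. KR_top n r i) = int r"
proof -
  have "(\<Sum>i\<in>Idx n. KR_top n r i) = (\<Sum>i\<in>Idx n. if i \<in> {1..int r} then 1 else 0)"
    by (rule sum.cong) (auto simp: KR_top_def)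
  also have "\<dots> = (\<Sum>i\<in>Idx n \<inter> {1..int r}. 1)"
    by (rule sum.inter_restrict[symmetric]) simp
  also have "Idx n \<inter> {1..int r} = {1..int r}"
    using assms by (auto simp: Idx_def)
  finally show ?thesis
    by simp
qed

lemma KR_top_in_KR_elems: "r < n \<Longrightarrow> KR_top n r \<in> KR_elems n r"
  using sum_KR_top[of r n] by (auto simp: KR_elems_def KR_top_def)

text \<open>Applied to the positions of the ones in a vector without ascents. Such a set fills the
  interval up to its maximum, which therefore equals its cardinality.\<close>

lemma down_closed_eq_atLeastAtMost:
  fixes S :: "int set"
  assumes fin: "finite S" and pos: "\<And>p. p \<in> S \<Longrightarrow> 1 \<le> p"
    and down: "\<And>p. p \<in> S \<Longrightarrow> 1 < p \<Longrightarrow> p - 1 \<in> S"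
  shows "S = {1..int (card S)}"
proof (cases "S = {}")
  case False
  have "{1..p} \<subseteq> S" if "p \<in> S" for p
  proof -
    have "p \<in> S \<longrightarrow> {1..p} \<subseteq> S" if "1 \<le> p"
      using that
    proof (induction p rule: int_ge_induct)
      case (step p)
      have "{1..p + 1} = insert (p + 1) {1..p}"
        using step(1) by auto
      then show ?case
        using step down[of "p + 1"] by auto
    qed auto
    then show ?thesis
      using that pos by blast
  qed
  then have "S = {1..Max S}"
    using fin False pos Max_in[of S] by fastforce
  moreover have "1 \<le> Max S"
    using pos[OF Max_in[OF fin False]] .
  ultimately obtain M where "S = {1..M}" "1 \<le> M"
    by blast
  then show ?thesis
    by simp
qed simp

text \<open>Without such an ascent the positions of the ones are closed under passing to the left,
  and there are \<open>r\<close> of them, so they are 1,...,r. An ascent at index 0 is excluded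
  because it would wrap around from position n to position 1.\<close>

lemma KR_ascent:
  assumes n: "n \<ge> 3" and r: "r < n" and x: "x \<in> KR_elems n r" and ne: "x \<noteq> KR_top n r"
  obtains i where "i \<in> Idx n" "i \<noteq> 0" "x i = 0" "x ((i + 1) mod int n) = 1"
proof (rule ccontr)
  assume "\<not> thesis"
  with that have no: "x i \<noteq> 0" if "i \<in> Idx n" "i \<noteq> 0" "x ((i + 1) mod int n) = 1" for i
    using that by blast
  \<comment> \<open>Positions run through 1,...,n in linear order; \<open>p mod int n\<close> sends
    position n to its storage index 0.\<close>
  define S where "S = {p \<in> {1..int n}. x (p mod int n) = 1}"
  have "S = {1..int (card S)}"
  proof (rule down_closed_eq_atLeastAtMost)
    show "finite S"
      unfolding S_def by (rule finite_Collect_conjI) simp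
  next
    fix p assume p: "p \<in> S" "1 < p"
    then have "p - 1 \<in> Idx n"
      by (auto simp: S_def Idx_def)
    \<comment> \<open>Since 1 < p, the index p - 1 is nonzero, so the absence of ascents applies and
      its successor is position p, also when p = n.\<close>
    then have "x (p - 1) = 1"
      using no[of "p - 1"] p KR_elems_value[OF x] by (auto simp: S_def)
    then show "p - 1 \<in> S"
      using p \<open>p - 1 \<in> Idx n\<close> by (auto simp: S_def Idx_mod)
  qed (auto simp: S_def)
  moreover have "int (card S) = int r"
  proof -
    have bij: "bij_betw (\<lambda>p. p mod int n) {1..int n} (Idx n)"
    proof (rule bij_betwI[where g = "\<lambda>i. if i = 0 then int n else i"])
      show "(\<lambda>p. p mod int n) \<in> {1..int n} \<rightarrow> Idx n"
        using n by (auto simp: Idx_def)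
      show "(if p mod int n = 0 then int n else p mod int n) = p" if "p \<in> {1..int n}" for p
        using that n by (cases "p = int n") auto
    qed (use n in \<open>auto simp: Idx_def\<close>)
    have "int (card S) = (\<Sum>p\<in>{1..int n}. if x (p mod int n) = 1 then 1 else 0)"
      by (simp add: S_def sum.If_cases Int_def conj_commute)
    also have "\<dots> = (\<Sum>p\<in>{1..int n}. x (p mod int n))"
    proof (rule sum.cong)
      fix p assume "p \<in> {1..int n}"
      then have "p mod int n \<in> Idx n"
        using bij by (auto simp: bij_betw_def)
      then show "(if x (p mod int n) = 1 then 1 else 0) = x (p mod int n)"
        using KR_elems_value[OF x] by force
    qed simp
    also have "\<dots> = (\<Sum>i\<in>Idx n. x i)"
      by (rule sum.reindex_bij_betw[OF bij])
    also have "\<dots> = int r"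
      using x by (simp add: KR_elems_def)
    finally show ?thesis .
  qed
  ultimately have S: "S = {1..int r}"
    by simp
  have "x i = KR_top n r i" for i
  proof (cases "i \<in> Idx n")
    case True
    define p where "p = (if i = 0 then int n else i)"
    have "p \<in> {1..int n}" "p mod int n = i"
      using True n by (auto simp: p_def Idx_def)
    then have "x i = 1 \<longleftrightarrow> p \<in> {1..int r}"
      using S unfolding S_def by blast
    \<comment> \<open>For \<open>i = 0\<close> both sides are false, as p = n exceeds r.\<close>
    also have "\<dots> \<longleftrightarrow> i \<in> {1..int r}"
      using r by (auto simp: p_def)
    finally show ?thesis
      using KR_elems_value[OF x True] True by (auto simp: KR_top_def)
  next
    case False
    then show ?thesis
      using x by (auto simp: KR_top_def KR_elems_def PiE_iff extensional_def)
  qed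
  then show False
    using ne by blast
qed

text \<open>Applying e_i at an ascent with nonzero index lowers the sum of the positions of the ones
  by 1, so repeated raising ends at \<open>KR_top\<close>. Read backwards, every element is reached
  from \<open>KR_top\<close> by f-steps alone.\<close>

lemma KR_connected_induct [consumes 3, case_names top step]:
  assumes n: "n \<ge> 3" and r: "r < n" and x: "x \<in> KR_elems n r"
    and top: "P (KR_top n r)"
    and step: "\<And>i x y. \<lbrakk>i \<in> Idx n; x \<in> KR_elems n r; P x; KR_f n i x = Some y\<rbrakk> \<Longrightarrow> P y"
  shows "P x"
proof -
  \<comment> \<open>The coordinate stored at index \<open>0\<close> is the last one, hence its weight \<open>n\<close>.\<close>
  define w where "w i = (if i = 0 then int n else i)" for i
  define pot where "pot x = (\<Sum>i\<in>Idx n. w i * x i)" for x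
  have pot_nonneg: "pot x \<ge> 0" if "x \<in> KR_elems n r" for x
    unfolding pot_def
  proof (rule sum_nonneg)
    fix i assume i: "i \<in> Idx n"
    then show "0 \<le> w i * x i"
      using KR_elems_value[OF that i] by (auto simp: w_def Idx_def)
  qed
  show ?thesis
    using x
  proof (induction "nat (pot x)" arbitrary: x rule: less_induct)
    case less
    show ?case
    proof (cases "x = KR_top n r")
      case False
      then obtain i where i: "i \<in> Idx n" "i \<noteq> 0" "x i = 0" "x ((i + 1) mod int n) = 1"
        using KR_ascent[OF n r less.prems] by blast
      define y where "y = x(i := 1, (i + 1) mod int n := 0)"
      have xy: "KR_e n i x = Some y"
        using i by (simp add: KR_e_def y_def)
      have y: "y \<in> KR_elems n r"
        using KR_e_closed[OF n i(1) less.prems xy] .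
      \<comment> \<open>This needs \<open>i \<noteq> 0\<close>. For i = n - 1 the successor is index
        0, whose weight n makes the step again equal to 1.\<close>
      have "w ((i + 1) mod int n) = w i + 1"
        using i(1,2) by (cases "i + 1 = int n") (auto simp: w_def Idx_def)
      then have "pot y = pot x - 1"
        using sum_swap_upd[OF n i(1), of "\<lambda>j a. w j * a" x 1 0] i(3,4) by (simp add: pot_def y_def)
      then have "P y"
        using less.hyps[OF _ y] pot_nonneg[OF y] by simp
      then show ?thesis
        using step[OF i(1) y] xy KR_f_iff_KR_e[OF n i(1)] by blast
    qed (use top in simp)
  qed
qed


section \<open>Products of variables of one level\<close>

text \<open>Arbitrary integer entries are allowed, so that a Nakajima operator's result with an
  entry 2 is still of this form before the modification discards it.\<close>

definition level_monomial :: "nat \<Rightarrow> int \<Rightarrow> (int \<Rightarrow> int) \<Rightarrow> monomial"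
  where "level_monomial n k x = (\<Sum>i\<in>Idx n. frag_cmul (x i) (X n i k))"

definition level_exponents :: "nat \<Rightarrow> int \<Rightarrow> (int \<Rightarrow> int) \<Rightarrow> ((int \<times> int) \<Rightarrow>\<^sub>0 int)"
  where "level_exponents n k x = (\<Sum>i\<in>Idx n. frag_cmul (x i) (frag_of (i, k)))"

lemma lookup_level_exponents:
  "Poly_Mapping.lookup (level_exponents n k x) (j, l) = (if j \<in> Idx n \<and> l = k then x j else 0)"
proof -
  have "Poly_Mapping.lookup (level_exponents n k x) (j, l) =
      (\<Sum>i\<in>Idx n. if i = j then (if l = k then x j else 0) else 0)"
    unfolding level_exponents_def lookup_sum by (rule sum.cong) auto
  then show ?thesis
    by simp
qed

lemma X_expression_level_monomial:
  "X_expression n (level_monomial n k x) (level_exponents n k x)"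
proof -
  have "Poly_Mapping.keys (level_exponents n k x) \<subseteq> Idx n \<times> UNIV"
    by (auto simp: in_keys_iff lookup_level_exponents split: if_splits)
  then show ?thesis
    by (simp add: X_expression_def level_monomial_def level_exponents_def
        frag_extend_sum frag_extend_cmul)
qed

text \<open>Uniqueness of the \<open>X\<close>-expression turns the existential in
  \<open>has_X_square\<close> into a test on the entries of \<open>x\<close>.\<close>

lemma has_X_square_level_monomial:
  assumes "n \<ge> 3"
  shows "has_X_square n (level_monomial n k x) \<longleftrightarrow> (\<exists>j\<in>Idx n. x j \<ge> 2)"
proof -
  have "X_expression n (level_monomial n k x) c \<longleftrightarrow> c = level_exponents n k x" for c
    using X_expression_unique[OF _ _ X_expression_level_monomial] X_expression_level_monomial assms
    by auto
  then show ?thesis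
    by (auto simp: has_X_square_def lookup_level_exponents)
qed

section \<open>Nakajima's statistics on level monomials\<close>

lemma lookup_level_monomial:
  assumes "n \<ge> 3" "j \<in> Idx n"
  shows "Poly_Mapping.lookup (level_monomial n k x) (j, l) =
    (if l = k then x j else 0) - (if l = k + 1 then x ((j + 1) mod int n) else 0)"
  using lookup_X_product[of n "level_exponents n k x" j l] assms
    X_expression_level_monomial[of n k x] succ_in_Idx[OF assms(1), of j]
  by (auto simp: X_expression_def lookup_level_exponents)

text \<open>Row \<open>i\<close> carries only x_i at level k and -x_{i+1} at level k + 1. Summing
  over these two levels adds at most zero terms to the support.\<close>

lemma head_sum_level_monomial:
  assumes "n \<ge> 3" "i \<in> Idx n"
  shows "head_sum i (level_monomial n k x) t =
    (if k \<le> t then x i else 0) - (if k + 1 \<le> t then x ((i + 1) mod int n) else 0)"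
proof -
  have "head_sum i (level_monomial n k x) t =
      (\<Sum>s\<in>{k, k + 1} \<inter> {..t}. Poly_Mapping.lookup (level_monomial n k x) (i, s))"
    unfolding head_sum_def
    by (rule sum.mono_neutral_left) (auto simp: lookup_level_monomial assms split: if_splits)
  moreover have "{k, k + 1} \<inter> {..t} =
      (if k + 1 \<le> t then {k, k + 1} else if k \<le> t then {k} else {})"
    by auto
  ultimately show ?thesis
    by (auto simp: lookup_level_monomial assms)
qed

lemma tail_sum_level_monomial:
  assumes "n \<ge> 3" "i \<in> Idx n"
  shows "tail_sum i (level_monomial n k x) t =
    (if t \<le> k then x i else 0) - (if t \<le> k + 1 then x ((i + 1) mod int n) else 0)"
proof -
  have "tail_sum i (level_monomial n k x) t =
      (\<Sum>s\<in>{k, k + 1} \<inter> {t..}. Poly_Mapping.lookup (level_monomial n k x) (i, s))"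
    unfolding tail_sum_def
    by (rule sum.mono_neutral_left) (auto simp: lookup_level_monomial assms split: if_splits)
  moreover have "{k, k + 1} \<inter> {t..} =
      (if t \<le> k then {k, k + 1} else if t \<le> k + 1 then {k + 1} else {})"
    by auto
  ultimately show ?thesis
    by (auto simp: lookup_level_monomial assms)
qed

text \<open>The head sums are 0, x_i and x_i - x_{i+1}. Their maximum ignores x_{i+1}, so the
  unmodified f_i acts even when x_{i+1} = 1; this is where squares arise.\<close>

lemma mon_phi_level_monomial:
  assumes "n \<ge> 3" "i \<in> Idx n" and "x i \<ge> 0" "x ((i + 1) mod int n) \<ge> 0"
  shows "mon_phi i (level_monomial n k x) = x i"
  unfolding mon_phi_def
proof (rule Max_eqI)
  show "finite (range (head_sum i (level_monomial n k x)))"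
    by (rule finite_range_head_sum)
  have "head_sum i (level_monomial n k x) k = x i"
    by (simp add: head_sum_level_monomial assms)
  then show "x i \<in> range (head_sum i (level_monomial n k x))"
    by (metis rangeI)
qed (use assms in \<open>auto simp: head_sum_level_monomial\<close>)

lemma mon_eps_level_monomial:
  assumes "n \<ge> 3" "i \<in> Idx n" and "x i \<ge> 0" "x ((i + 1) mod int n) \<ge> 0"
  shows "mon_eps i (level_monomial n k x) = x ((i + 1) mod int n)"
proof -
  have "Min (range (tail_sum i (level_monomial n k x))) = - x ((i + 1) mod int n)"
  proof (rule Min_eqI)
    show "finite (range (tail_sum i (level_monomial n k x)))"
      by (rule finite_range_tail_sum)
    have "tail_sum i (level_monomial n k x) (k + 1) = - x ((i + 1) mod int n)"
      by (simp add: tail_sum_level_monomial assms)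
    then show "- x ((i + 1) mod int n) \<in> range (tail_sum i (level_monomial n k x))"
      by (metis rangeI)
  qed (use assms in \<open>auto simp: tail_sum_level_monomial\<close>)
  then show ?thesis
    by (simp add: mon_eps_def)
qed

lemma k_f_level_monomial:
  assumes "n \<ge> 3" "i \<in> Idx n" and "x i > 0" "x ((i + 1) mod int n) \<ge> 0"
  shows "k_f i (level_monomial n k x) = k"
  unfolding k_f_def
  by (rule Least_equality)
    (use assms in \<open>auto simp: mon_phi_level_monomial head_sum_level_monomial split: if_splits\<close>)

text \<open>The shift by 1 cancels against the \<open>k_e i m - 1\<close> in \<open>mon_e\<close>,
  so both operators multiply by a power of A_{i,k} at the same level k.\<close>

lemma k_e_level_monomial:
  assumes "n \<ge> 3" "i \<in> Idx n" and "x i \<ge> 0" "x ((i + 1) mod int n) > 0"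
  shows "k_e i (level_monomial n k x) = k + 1"
  unfolding k_e_def
  by (rule Greatest_equality)
    (use assms in \<open>auto simp: mon_eps_level_monomial tail_sum_level_monomial split: if_splits\<close>)

section \<open>The modified operators on level monomials\<close>

lemma A_eq_X_diff: "A n i k = X n i k - X n (i + 1) k"
  by (simp add: A_def X_def)

text \<open>Taking \<open>d = 1\<close> describes e_i and \<open>d = -1\<close> describes f_i,
  regardless of whether the new entries stay in {0, 1}.\<close>

lemma level_monomial_swap:
  assumes "n \<ge> 3" "i \<in> Idx n"
  shows "level_monomial n k (x(i := x i + d, (i + 1) mod int n := x ((i + 1) mod int n) - d)) =
    level_monomial n k x + frag_cmul d (A n i k)"
proof -
  have X_mod: "X n ((i + 1) mod int n) k = X n (i + 1) k"
    by (simp add: X_def Y_def mod_diff_left_eq)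
  show ?thesis
    unfolding level_monomial_def sum_swap_upd[OF assms, of "\<lambda>i a. frag_cmul a (X n i k)"]
      A_eq_X_diff X_mod
    by (intro poly_mapping_eqI) (simp add: lookup_add lookup_minus algebra_simps)
qed

lemma f_bar_level_monomial:
  assumes n: "n \<ge> 3" and i: "i \<in> Idx n" and x: "x \<in> KR_elems n r"
  shows "f_bar n i (level_monomial n k x) = map_option (level_monomial n k) (KR_f n i x)"
proof -
  let ?s = "(i + 1) mod int n"
  \<comment> \<open>The exponents after the unmodified f_i. This vector may leave B^{r,1}, with
    entry 2 at \<open>?s\<close>.\<close>
  let ?y = "x(i := x i - 1, ?s := x ?s + 1)"
  note s = succ_in_Idx[OF n, of i] and val = KR_elems_value[OF x]
  show ?thesis
  proof (cases "x i = 0")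
    case True
    then show ?thesis
      using val[OF s]
      by (auto simp: f_bar_def mon_f_def mon_phi_level_monomial n i remove_X_squares_def KR_f_def)
  next
    case False
    then have xi: "x i = 1"
      using val[OF i] by blast
    have "mon_f n i (level_monomial n k x) = Some (level_monomial n k ?y)"
      using xi val[OF s] level_monomial_swap[OF n i, of k x "-1"]
      by (auto simp: mon_f_def mon_phi_level_monomial k_f_level_monomial n i)
    \<comment> \<open>Only the incremented entry can reach 2, and it does so exactly when
      \<open>KR_f\<close> is blocked by x_{i+1} = 1.\<close>
    moreover have "2 \<le> ?y j \<longleftrightarrow> j = ?s \<and> x ?s = 1" if "j \<in> Idx n" for j
      using xi val[OF that] val[OF s] by (elim disjE) simp_all
    then have "has_X_square n (level_monomial n k ?y) \<longleftrightarrow> x ?s = 1"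
      unfolding has_X_square_level_monomial[OF n] using s by blast
    ultimately show ?thesis
      using xi val[OF s] by (elim disjE) (simp_all add: f_bar_def remove_X_squares_def KR_f_def)
  qed
qed

text \<open>Mirror image of the case of \<open>f_bar\<close>: the new factor is X_{i,k}, so a square
  appears exactly when x_i = 1.\<close>

lemma e_bar_level_monomial:
  assumes n: "n \<ge> 3" and i: "i \<in> Idx n" and x: "x \<in> KR_elems n r"
  shows "e_bar n i (level_monomial n k x) = map_option (level_monomial n k) (KR_e n i x)"
proof -
  let ?s = "(i + 1) mod int n"
  let ?y = "x(i := x i + 1, ?s := x ?s - 1)"
  note s = succ_in_Idx[OF n, of i] and val = KR_elems_value[OF x]
  show ?thesis
  proof (cases "x ?s = 0")
    case True
    then show ?thesis
      using val[OF i]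
      by (auto simp: e_bar_def mon_e_def mon_eps_level_monomial n i remove_X_squares_def KR_e_def)
  next
    case False
    then have xs: "x ?s = 1"
      using val[OF s] by blast
    have "mon_e n i (level_monomial n k x) = Some (level_monomial n k ?y)"
      using xs val[OF i] level_monomial_swap[OF n i, of k x 1]
      by (auto simp: mon_e_def mon_eps_level_monomial k_e_level_monomial n i)
    moreover have "2 \<le> ?y j \<longleftrightarrow> j = i \<and> x i = 1" if "j \<in> Idx n" for j
      using xs val[OF that] val[OF i] succ_neq[OF n i] by (elim disjE) simp_all
    then have "has_X_square n (level_monomial n k ?y) \<longleftrightarrow> x i = 1"
      unfolding has_X_square_level_monomial[OF n] using i by blast
    ultimately show ?thesis
      using xs val[OF i] by (elim disjE) (simp_all add: e_bar_def remove_X_squares_def KR_e_def)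
  qed
qed

section \<open>Weights, injectivity and the closure\<close>

lemma mon_wt_level_monomial:
  assumes "n \<ge> 3"
  shows "mon_wt n (level_monomial n k x) = KR_wt n x"
proof -
  have "mon_wt n (X n i k) = fund_weight n i - fund_weight n (i - 1)" for i
    by (simp add: mon_wt_def X_def Y_def frag_extend_diff)
  then show ?thesis
    by (simp add: KR_wt_eq[OF assms] level_monomial_def mon_wt_def frag_extend_sum frag_extend_cmul)
qed

lemma inj_on_level_monomial:
  assumes "n \<ge> 3"
  shows "inj_on (level_monomial n k) (KR_elems n r)"
proof (rule inj_onI)
  fix x y assume xy: "x \<in> KR_elems n r" "y \<in> KR_elems n r"
    and eq: "level_monomial n k x = level_monomial n k y"
  \<comment> \<open>The exponent of Y_{i,k} is x_i itself, since the contribution of x_{i+1} sits at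
    level k + 1.\<close>
  have "x i = y i" if "i \<in> Idx n" for i
    using lookup_level_monomial[OF assms that, of k x k] lookup_level_monomial[OF assms that, of k y k]
    by (simp add: eq)
  then show "x = y"
    using xy by (auto simp: KR_elems_def intro: PiE_ext)
qed

lemma level_monomial_KR_top:
  assumes "r < n"
  shows "level_monomial n k (KR_top n r) = (\<Sum>i=1..int r. X n i k)"
proof -
  have "level_monomial n k (KR_top n r) =
      (\<Sum>i\<in>Idx n. if i \<in> {1..int r} then X n i k else 0)"
    unfolding level_monomial_def by (rule sum.cong) (auto simp: KR_top_def)
  also have "\<dots> = (\<Sum>i\<in>Idx n \<inter> {1..int r}. X n i k)"
    by (rule sum.inter_restrict[symmetric]) simp
  also have "Idx n \<inter> {1..int r} = {1..int r}"
    using assms by (auto simp: Idx_def)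
  finally show ?thesis .
qed

text \<open>The image contains the generator and is stable under the modified operators, which gives
  one inclusion. The other is connectedness of B^{r,1}, with each f-step transferred to the
  closure.\<close>

lemma M_bar_eq_image:
  assumes n: "n \<ge> 3" and r: "r < n"
  shows "M_bar n (\<Sum>i=1..int r. X n i k) = level_monomial n k ` KR_elems n r"
proof (intro equalityI subsetI)
  fix m assume "m \<in> M_bar n (\<Sum>i=1..int r. X n i k)"
  then show "m \<in> level_monomial n k ` KR_elems n r"
  proof induction
    case base
    then show ?case
      using level_monomial_KR_top[OF r] KR_top_in_KR_elems[OF r] by (metis imageI)
  next
    case (e_step m i m')
    then show ?case
      using KR_e_closed[OF n] by (auto simp: e_bar_level_monomial[OF n])
  next
    case (f_step m i m')
    then show ?case
      using KR_f_closed[OF n] by (auto simp: f_bar_level_monomial[OF n])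
  qed
next
  fix m assume "m \<in> level_monomial n k ` KR_elems n r"
  then obtain x where "x \<in> KR_elems n r" and m: "m = level_monomial n k x"
    by blast
  from n r this(1) show "m \<in> M_bar n (\<Sum>i=1..int r. X n i k)"
    unfolding m
  proof (induction rule: KR_connected_induct)
    case top
    then show ?case
      using level_monomial_KR_top[OF r] M_bar.base by simp
  next
    case (step i x y)
    then show ?case
      using M_bar.f_step f_bar_level_monomial[OF n step(1,2)] by simp
  qed
qed

theorem proposition5p2:
  fixes n r :: nat and k :: int
  assumes "n \<ge> 3" and "r \<in> {1..n - 1}"
  shows "crystals_isomorphic n (KR_crystal n r) (M_bar_crystal n (\<Sum>i=1..int r. X n i k))"
proof -
  have r: "r < n"
    using assms by auto
  let ?B = "KR_crystal n r" and ?C = "M_bar_crystal n (\<Sum>i=1..int r. X n i k)"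
  \<comment> \<open>On both sides eps and phi are string lengths, so intertwining the operators
    suffices to match them.\<close>
  have "string_length (e_bar n i) (level_monomial n k x) = string_length (KR_e n i) x"
    "string_length (f_bar n i) (level_monomial n k x) = string_length (KR_f n i) x"
    if "i \<in> Idx n" "x \<in> KR_elems n r" for i x
    using that assms(1)
    by (auto intro!: string_length_map[where S = "KR_elems n r"]
        e_bar_level_monomial f_bar_level_monomial intro: KR_e_closed KR_f_closed)
  then have "crystal_isomorphism n ?B ?C (level_monomial n k)"
    using M_bar_eq_image[OF assms(1) r] inj_on_level_monomial[OF assms(1)]
      e_bar_level_monomial[OF assms(1)] f_bar_level_monomial[OF assms(1)]
      mon_wt_level_monomial[OF assms(1)]
    by (auto simp: crystal_isomorphism_def KR_crystal_def M_bar_crystal_def bij_betw_def)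
  then show ?thesis
    using is_crystal_KR[OF assms(1)] is_crystal_transport
    unfolding crystals_isomorphic_def by blast
qed

end
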